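(* The Balance SWOR algorithm is at least $0.513$-competitive for Online Bipartite Matching; that is, for every bipartite graph $G=(I,J,E)$ and every arrival order of the online vertices, the expected size of the matching produced by Balance SWOR is at least $0.513$ times the size of a maximum matching of $G$.
   Context: Online Bipartite Matching: $G=(I,J,E)$ is a bipartite graph with online vertices $I=\{1,\dots,n\}$ (indexed by arrival order) and offline vertices $J$; $J_i$ denotes the set of neighbors of $i\in I$. The algorithm knows $J$ in advance; online vertices arrive one at a time, and when $i$ arrives its incident edges are revealed and the algorithm must immediately and irrevocably match $i$ to an unmatched neighbor or leave it unmatched. An algorithm is $\Gamma$-competitive if for every graph and arrival order its expected matching size (over its internal randomness) is at least $\Gamma$ times the maximum matching size. Balance SWOR: maintain $y_j^i$ for $j\in J$, with $y_j^0=0$. When online vertex $i$ arrives (with $J_i\neq\emptyset$), find the threshold $\bar y>0$ with $\sum_{j\in J_i}(\bar y-y_j^{i-1})^+=1$, where $a^+=\max\{a,0\}$; set $x_{ij}=(\bar y-y_j^{i-1})^+$ for $j\in J_i$ and $x_{ij}=0$ otherwise, and $y_j^i=y_j^{i-1}+x_{ij}$ (this is the "unbounded Balance" fractional allocation). Then match $i$ to an unmatched neighbor $j$ with probability proportional to $x_{ij}$, i.e. with probability $x_{ij}/\sum_{k\in J_i\text{ unmatched}}x_{ik}$ (in the degenerate case where every unmatched neighbor has $x_{ij}=0$, $i$ may be matched to any unmatched neighbor or left unmatched). *)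

theory Defs
  imports "HOL-Probability.Probability"
begin

section \<open>Bipartite graphs with online and offline vertices\<close>

text \<open>Online vertices are numbered \<open>1, ..., n\<close> in the order of their arrival, so that ranging over
  all edge sets also ranges over all arrival orders.\<close>

definition online_bipartite_graph :: "nat \<Rightarrow> 'b set \<Rightarrow> (nat \<times> 'b) set \<Rightarrow> bool" where
  "online_bipartite_graph n J E \<longleftrightarrow> finite J \<and> E \<subseteq> {1..n} \<times> J"

definition neighbors :: "(nat \<times> 'b) set \<Rightarrow> nat \<Rightarrow> 'b set" where
  "neighbors E i = {j. (i, j) \<in> E}"

definition matching :: "(nat \<times> 'b) set \<Rightarrow> (nat \<times> 'b) set \<Rightarrow> bool" where
  "matching E M \<longleftrightarrow> M \<subseteq> E \<and> inj_on fst M \<and> inj_on snd M"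

definition max_matching_size :: "(nat \<times> 'b) set \<Rightarrow> nat" where
  "max_matching_size E = Max (card ` {M. matching E M})"


section \<open>The unbounded Balance fractional allocation\<close>

definition threshold :: "('b \<Rightarrow> real) \<Rightarrow> 'b set \<Rightarrow> real" where
  "threshold y S = (THE t. t > 0 \<and> (\<Sum>j\<in>S. max (t - y j) 0) = 1)"

definition balance_alloc :: "('b \<Rightarrow> real) \<Rightarrow> 'b set \<Rightarrow> 'b \<Rightarrow> real" where
  "balance_alloc y S j = (if j \<in> S then max (threshold y S - y j) 0 else 0)"

primrec balance_y :: "(nat \<times> 'b) set \<Rightarrow> nat \<Rightarrow> 'b \<Rightarrow> real" where
  "balance_y E 0 = (\<lambda>j. 0)"
| "balance_y E (Suc i) =
     (\<lambda>j. balance_y E i j + balance_alloc (balance_y E i) (neighbors E (Suc i)) j)"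

definition balance_x :: "(nat \<times> 'b) set \<Rightarrow> nat \<Rightarrow> 'b \<Rightarrow> real" where
  "balance_x E i = balance_alloc (balance_y E (i - 1)) (neighbors E i)"

lemma balance_y_nonneg: "balance_y E i j \<ge> 0"
  by (induction i) (auto simp: balance_alloc_def)

lemma threshold_ex1:
  fixes y :: "'b \<Rightarrow> real"
  assumes "finite S" "S \<noteq> {}" and y: "\<And>j. j \<in> S \<Longrightarrow> y j \<ge> 0"
  shows "\<exists>!t. t > 0 \<and> (\<Sum>j\<in>S. max (t - y j) 0) = 1"
proof -
  define f where "f t = (\<Sum>j\<in>S. max (t - y j) 0)" for t
  obtain k where k: "k \<in> S" using assms by blast
  have f0: "f 0 = 0" unfolding f_def using y by (intro sum.neutral) auto
  have "max (y k + 1 - y k) 0 \<le> f (y k + 1)"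
    unfolding f_def by (rule member_le_sum[OF k]) (use assms in auto)
  hence f1: "f (y k + 1) \<ge> 1" by simp
  have cont: "continuous_on {0..y k + 1} f"
    unfolding f_def by (intro continuous_intros)
  have "\<exists>t\<ge>0. t \<le> y k + 1 \<and> f t = 1"
    by (rule IVT') (use f0 f1 cont y[OF k] in auto)
  then obtain t where t: "t \<ge> 0" "f t = 1" by blast
  have less: "f a < f b" if "a < b" "f a = 1" for a b
  proof -
    have "\<exists>j\<in>S. a - y j > 0"
    proof (rule ccontr)
      assume "\<not> ?thesis"
      hence "f a = 0" unfolding f_def by (intro sum.neutral) auto
      thus False using that by simp
    qed
    then obtain j where j: "j \<in> S" "a - y j > 0" by blast
    show ?thesis unfolding f_def
      by (rule sum_strict_mono_ex1) (use assms that j in \<open>auto intro!: bexI[of _ j]\<close>)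
  qed
  have "t > 0" using t f0 by (cases "t = 0") auto
  moreover have "s = t" if "f s = 1" for s
    using less[of s t] less[of t s] that t(2) by (cases s t rule: linorder_cases) auto
  ultimately show ?thesis using t(2) unfolding f_def by blast
qed


section \<open>Balance SWOR\<close>

definition unmatched_neighbors :: "(nat \<times> 'b) set \<Rightarrow> nat \<Rightarrow> (nat \<times> 'b) set \<Rightarrow> 'b set" where
  "unmatched_neighbors E i M = neighbors E i - snd ` M"

text \<open>\<open>K i M\<close> is the distribution of the partner of \<open>i\<close> (\<open>None\<close>: left unmatched) given
  the matching \<open>M\<close> built from the arrivals before \<open>i\<close>. If some unmatched neighbor has positive
  \<open>x\<close>, the prescribed probabilities sum to 1 and determine \<open>K i M\<close>.
  In the degenerate case the choice may be random and may depend on \<open>i\<close> and \<open>M\<close>.\<close>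

definition balance_swor :: "nat \<Rightarrow> (nat \<times> 'b) set \<Rightarrow>
    (nat \<Rightarrow> (nat \<times> 'b) set \<Rightarrow> 'b option pmf) \<Rightarrow> bool" where
  "balance_swor n E K \<longleftrightarrow> (\<forall>i\<in>{1..n}. \<forall>M.
     let U = unmatched_neighbors E i M in
     if \<exists>j\<in>U. balance_x E i j > 0
     then \<forall>j\<in>U. pmf (K i M) (Some j) = balance_x E i j / (\<Sum>k\<in>U. balance_x E i k)
     else set_pmf (K i M) \<subseteq> insert None (Some ` U))"

primrec matching_after ::
    "(nat \<Rightarrow> (nat \<times> 'b) set \<Rightarrow> 'b option pmf) \<Rightarrow> nat \<Rightarrow> (nat \<times> 'b) set pmf" where
  "matching_after K 0 = return_pmf {}"
| "matching_after K (Suc i) =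
     bind_pmf (matching_after K i) (\<lambda>M.
       map_pmf (\<lambda>c. case c of None \<Rightarrow> M | Some j \<Rightarrow> insert (Suc i, j) M) (K (Suc i) M))"

lemma balance_swor_exists:
  assumes "online_bipartite_graph n J E"
  shows "\<exists>K. balance_swor n E K"
proof -
  have fin: "finite (unmatched_neighbors E i M)" for i M
    by (rule finite_subset[of _ J])
       (use assms in \<open>auto simp: unmatched_neighbors_def neighbors_def online_bipartite_graph_def\<close>)
  have "\<exists>p. let U = unmatched_neighbors E i M in
     if \<exists>j\<in>U. balance_x E i j > 0
     then \<forall>j\<in>U. pmf p (Some j) = balance_x E i j / (\<Sum>k\<in>U. balance_x E i k)
     else set_pmf p \<subseteq> insert None (Some ` U)" for i M
  proof -
    define U where "U = unmatched_neighbors E i M"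
    define s where "s = (\<Sum>k\<in>U. balance_x E i k)"
    have nn: "balance_x E i j \<ge> 0" for j
      by (simp add: balance_x_def balance_alloc_def)
    show ?thesis
    proof (cases "\<exists>j\<in>U. balance_x E i j > 0")
      case True
      hence s: "s > 0" unfolding s_def
        using fin nn by (auto simp: U_def intro!: sum_pos2)
      define g where "g j = (if j \<in> U then balance_x E i j / s else 0)" for j
      have "(\<integral>\<^sup>+ j. ennreal (g j) \<partial>count_space UNIV) = (\<Sum>j\<in>U. ennreal (g j))"
        by (rule nn_integral_count_space') (use fin in \<open>auto simp: g_def U_def\<close>)
      also have "\<dots> = ennreal (\<Sum>j\<in>U. g j)"
        by (rule sum_ennreal) (use nn s in \<open>auto simp: g_def\<close>)
      also have "(\<Sum>j\<in>U. g j) = 1"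
        using s by (simp add: g_def s_def flip: sum_divide_distrib)
      finally have one: "(\<integral>\<^sup>+ j. ennreal (g j) \<partial>count_space UNIV) = 1" by simp
      have "pmf (map_pmf Some (embed_pmf g)) (Some j) = g j" for j
        using pmf_embed_pmf[of g j] one nn s
        by (simp add: pmf_map_inj' g_def)
      thus ?thesis using True
        by (auto simp: Let_def U_def[symmetric] s_def[symmetric] g_def
                 intro!: exI[of _ "map_pmf Some (embed_pmf g)"])
    next
      case False
      thus ?thesis
        by (auto simp: Let_def U_def[symmetric] intro!: exI[of _ "return_pmf None"])
    qed
  qed
  then obtain K where "\<And>i M. let U = unmatched_neighbors E i M in
     if \<exists>j\<in>U. balance_x E i j > 0
     then \<forall>j\<in>U. pmf (K i M) (Some j) = balance_x E i j / (\<Sum>k\<in>U. balance_x E i k)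
     else set_pmf (K i M) \<subseteq> insert None (Some ` U)"
    by metis
  thus ?thesis unfolding balance_swor_def by blast
qed

end

theory Submission
  imports Defs
begin

text \<open>By induction over the arrivals, a set \<open>S\<close> of offline vertices is entirely unmatched with probability
  at most the product of \<open>exp (- decay y\<^sub>j)\<close> over \<open>j\<close> in \<open>S\<close>: given the unmatched neighbors, an arrival
  spares \<open>S\<close> with probability \<open>X / (x(S) + X)\<close>, where \<open>X\<close> is the total \<open>x\<close> of the unmatched
  neighbors outside \<open>S\<close>; this is concave in \<open>X\<close>, and the expectation of \<open>X\<close> restricted to the event
  that \<open>S\<close> is unmatched is governed by the induction hypothesis for \<open>S\<close> with one more vertex.
  Hence the expected matching is at least the sum of \<open>1 - exp (- decay y\<^sub>j)\<close>. A primal-dual argument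
  compares this with the optimum: \<open>price\<close> at the threshold pays for an online vertex, and
  \<open>price 0 - price y\<^sub>j\<close> for an offline one.\<close>

section \<open>The decay rate of the survival probability\<close>

text \<open>The worst case for \<open>j\<close> at level \<open>y\<close> is an infinitesimal fill while the other neighbors rise from
  \<open>max 0 (y - 1)\<close> to \<open>y\<close>, hence the rate \<open>1\<close> for \<open>y \<le> 1\<close> and
  \<open>exp (decay (y - 1))\<close> for \<open>y \<ge> 1\<close>; the latter equals \<open>exp (y - 1)\<close> up to \<open>y = 2\<close> and is bounded below by it afterwards.\<close>

definition decay :: "real \<Rightarrow> real" where
  "decay y = (if y \<le> 1 then y else exp (y - 1))"

lemma decay_mono: "y \<le> z \<Longrightarrow> decay y \<le> decay z"
  unfolding decay_def using exp_ge_add_one_self[of "z - 1"] by auto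

lemma decay_nonneg: "0 \<le> y \<Longrightarrow> 0 \<le> decay y"
  by (simp add: decay_def)

text \<open>\<open>decay\<close> is convex and \<open>max 1 (exp (z - 1))\<close> is its slope at
  \<open>z\<close>; the tangent there lies below the graph.\<close>

lemma decay_increment_le:
  assumes "y \<le> z"
  shows "decay z - decay y \<le> max 1 (exp (z - 1)) * (z - y)"
proof -
  consider "z \<le> 1" | "1 < y" | "y \<le> 1" "1 < z" using assms by linarith
  then show ?thesis
  proof cases
    case 1
    then show ?thesis using assms by (simp add: decay_def max_def)
  next
    case 2
    have "exp (z - 1) * (1 + (y - z)) \<le> exp (z - 1) * exp (y - z)"
      by (intro mult_left_mono exp_ge_add_one_self) simp
    also have "\<dots> = exp (y - 1)" by (simp flip: exp_add)
    finally show ?thesis using 2 assms by (simp add: decay_def max_def algebra_simps)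
  next
    case 3
    define a where "a = z - 1"
    have a: "a > 0" "exp a \<ge> 1" using 3 by (auto simp: a_def)
    have "exp a * (1 + (- a)) \<le> exp a * exp (- a)"
      by (intro mult_left_mono exp_ge_add_one_self) simp
    also have "\<dots> = 1" by (simp flip: exp_add)
    finally have "exp a * (1 - a) \<le> 1" by simp
    moreover have "(exp a - 1) * (1 - y) \<ge> 0" using a 3 by simp
    ultimately have "exp a * (y - a) \<le> y" by (simp add: algebra_simps)
    moreover have "z = a + 1" by (simp add: a_def)
    ultimately show ?thesis using 3 a by (simp add: decay_def max_def algebra_simps)
  qed
qed

text \<open>Weighted AM-GM with the weights \<open>1 - c\<close> and \<open>c\<close> removes \<open>u\<close> and leaves an inequality
  between logarithms of \<open>1 - s\<close> and \<open>1 - c\<close>.\<close>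

lemma exp_mixture_bound:
  fixes s u :: real
  assumes s: "0 < s" "s < 1"
  defines "c \<equiv> s * exp (1 - s)"
  shows "(1 - s) * exp (c * u) \<le> 1 - s + s * exp u"
proof -
  have "s < exp (s - 1)" using exp_minus_greater[of "1 - s"] s by simp
  then have "s * exp (1 - s) < exp (s - 1) * exp (1 - s)" by simp
  then have c: "0 < c" "c < 1" using s unfolding c_def by (auto simp flip: exp_add)
  \<comment> \<open>\<open>q\<close> is a Taylor lower bound for \<open>exp s\<close>. With
    \<open>e_less_272\<close> it bounds \<open>exp (1 - s)\<close> by a rational function, sharply
    enough for \<open>c * (1 + c) \<le> 4 * s\<close>, to which the final comparison comes
    down.\<close>
  define q where "q = 1 + s + s\<^sup>2 / 2"
  have q: "q > 0" using s by (auto simp: q_def intro!: add_pos_nonneg)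
  have eq: "exp (1 - s) \<le> 2.72 / q"
  proof -
    have "q \<le> exp s" using exp_lower_Taylor_quadratic[of s] s by (simp add: q_def)
    then have "exp 1 / exp s \<le> 2.72 / q"
      using e_less_272 q by (intro frac_le) auto
    then show ?thesis by (simp add: exp_diff)
  qed
  have cq: "c \<le> s * (2.72 / q)" unfolding c_def using eq s by (intro mult_left_mono) auto
  have "exp (1 - s) * (1 + c) \<le> 2.72 / q * (1 + s * (2.72 / q))"
    using eq cq c q s by (intro mult_mono) auto
  also have "\<dots> = 2.72 * (q + 2.72 * s) / q\<^sup>2"
    using q by (simp add: field_simps power2_eq_square)
  also have "\<dots> \<le> 4"
  proof -
    have "2.72 * (q + 2.72 * s) \<le> 4 * q\<^sup>2"
    proof -
      have "4 * q\<^sup>2 - 2.72 * (q + 2.72 * s)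
          = 1.28 - 2.1184 * s + 6.64 * s\<^sup>2 + 4 * s ^ 3 + s ^ 4"
        by (simp add: q_def algebra_simps power2_eq_square power3_eq_cube power4_eq_xxxx)
      moreover have "1.28 - 2.1184 * s + 6.64 * s\<^sup>2 \<ge> 0"
      proof -
        \<comment> \<open>The vertex \<open>2.1184 / 13.28\<close> of the parabola is rounded to
          \<open>0.16\<close>, which leaves the nonnegative term \<open>0.0064 * s\<close>.\<close>
        have "1.28 - 2.1184 * s + 6.64 * s\<^sup>2 = 6.64 * (s - 0.16)\<^sup>2 + 1.110016 + 0.0064 * s"
          by (simp add: algebra_simps power2_eq_square)
        then show ?thesis using s by simp
      qed
      moreover have "s ^ 3 \<ge> 0" "s ^ 4 \<ge> 0" using s by auto
      ultimately show ?thesis by linarith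
    qed
    then show ?thesis using q by (simp add: field_simps)
  qed
  finally have "s * (exp (1 - s) * (1 + c)) \<le> s * 4" using s by (intro mult_left_mono) auto
  then have c4: "c * (1 + c) \<le> 4 * s" by (simp add: c_def mult_ac)
  have ln_s: "ln (1 - s) \<le> - s" using s by (intro ln_one_minus_pos_upper_bound) auto
  have ln_c: "ln (1 - c) \<le> - c - c\<^sup>2 / 2"
  proof -
    have "exp (c + c\<^sup>2 / 2) * (1 - c) \<le> 1"
    proof -
      define f where "f x = exp (x + x\<^sup>2 / 2) * (1 - x)" for x :: real
      have "f c \<le> f 0"
      proof (rule DERIV_nonpos_imp_nonincreasing[where f = f])
        fix x :: real assume x: "0 \<le> x" "x \<le> c"
        have "(f has_real_derivative - (exp (x + x\<^sup>2 / 2) * x\<^sup>2)) (at x)"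
          unfolding f_def
          by (auto intro!: derivative_eq_intros simp: algebra_simps power2_eq_square)
        then show "\<exists>y. (f has_real_derivative y) (at x) \<and> y \<le> 0"
          by (intro exI[of _ "- (exp (x + x\<^sup>2 / 2) * x\<^sup>2)"]) auto
      qed (use c in auto)
      then show ?thesis by (simp add: f_def)
    qed
    then have "1 - c \<le> exp (- (c + c\<^sup>2 / 2))"
      by (simp add: exp_minus field_simps)
    then have "ln (1 - c) \<le> ln (exp (- (c + c\<^sup>2 / 2)))"
      using c by (subst ln_le_cancel_iff) auto
    then show ?thesis by simp
  qed
  \<comment> \<open>Chosen so that \<open>(1 - c) * exp A + c * exp B\<close> is exactly the
    right-hand side; \<open>c * B\<close> contributes \<open>c * u\<close>, which cancels in the
    next claim.\<close>
  define A where "A = ln (1 - s) - ln (1 - c)"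
  define B where "B = s - 1 + u"
  have "ln (1 - s) + c * u \<le> (1 - c) * A + c * B"
  proof -
    have "c * ln (1 - s) \<le> c * (- s)" using c ln_s by (intro mult_left_mono) auto
    moreover have "(1 - c) * ln (1 - c) \<le> (1 - c) * (- c - c\<^sup>2 / 2)"
      using c ln_c by (intro mult_left_mono) auto
    moreover have "(1 - c) * (- c - c\<^sup>2 / 2) = c * (c * (1 + c)) / 2 - c"
      by (simp add: field_simps power2_eq_square)
    moreover have "c * (c * (1 + c)) \<le> c * (4 * s)" using c c4 by (intro mult_left_mono) auto
    moreover have "(1 - c) * A + c * B
        = ln (1 - s) + c * u - c * ln (1 - s) - (1 - c) * ln (1 - c) + c * s - c"
      by (simp add: A_def B_def algebra_simps)
    ultimately show ?thesis by simp
  qed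
  then have "exp (ln (1 - s) + c * u) \<le> exp ((1 - c) * A + c * B)" by simp
  also have "\<dots> \<le> (1 - c) * exp A + c * exp B"
    using convex_onD[OF exp_convex, of c A B] c by simp
  also have "(1 - c) * exp A = 1 - s"
    using c s by (simp add: A_def exp_diff)
  also have "c * exp B = s * exp u"
    by (simp add: c_def B_def flip: exp_add)
  finally show ?thesis using s by (simp add: exp_add)
qed

text \<open>This is \<open>survival_ratio_le\<close> at the largest admissible \<open>T\<close>,
  with denominators cleared. For \<open>t > 1\<close> the exponent on the left is
  \<open>c * v\<close> with \<open>c\<close> as in \<open>exp_mixture_bound\<close>, and
  \<open>v\<close> is the \<open>decay\<close> of the lowered level once that level exceeds
  1.\<close>

lemma exp_mixture_decay_bound:
  fixes s t :: real
  assumes s: "0 < s" "s < 1"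
  shows "(1 - s) * exp (s * max 1 (exp (t - 1)))
    \<le> 1 - s + s * exp (decay (max 0 (t - (1 - s))))"
proof (cases "t \<le> 1")
  case True
  have "(1 - s) * exp s \<le> exp (- s) * exp s"
    using exp_ge_add_one_self[of "- s"] by (intro mult_right_mono) auto
  also have "\<dots> = 1 - s + s * exp 0" by (simp flip: exp_add)
  also have "\<dots> \<le> 1 - s + s * exp (decay (max 0 (t - (1 - s))))"
    using s by (intro add_left_mono mult_left_mono) (auto intro: decay_nonneg)
  finally have "(1 - s) * exp (s * 1) \<le> 1 - s + s * exp (decay (max 0 (t - (1 - s))))" by simp
  moreover have "max 1 (exp (t - 1)) = 1" using True by simp
  ultimately show ?thesis by (simp only:)
next
  case False
  define c where "c = s * exp (1 - s)"
  define v where "v = exp (t + s - 2)"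
  have sc: "s * exp (t - 1) = c * v" by (simp add: c_def v_def flip: exp_add)
  have m: "max 1 (exp (t - 1)) = exp (t - 1)" "max 0 (t - (1 - s)) = t + s - 1"
    using False s by auto
  show ?thesis
  proof (cases "t + s - 1 \<le> 1")
    case True
    then have v: "0 < v" "v \<le> 1" by (auto simp: v_def)
    \<comment> \<open>The lowered level is still in the linear range. The chord of
      \<open>exp\<close> between \<open>0\<close> and \<open>c\<close> reduces the claim to
      \<open>exp_mixture_bound\<close> at \<open>u = 1\<close>, because \<open>v * exp 1\<close> is
      \<open>exp (t + s - 1)\<close>.\<close>
    have "exp (c * v) \<le> 1 - v + v * exp c"
      using convex_onD[OF exp_convex, of v 0 c] v by (simp add: mult.commute)
    then have "(1 - s) * exp (c * v) \<le> (1 - s) * (1 - v + v * exp c)"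
      using s by (intro mult_left_mono) auto
    also have "\<dots> = (1 - s) * (1 - v) + v * ((1 - s) * exp (c * 1))" by (simp add: algebra_simps)
    also have "\<dots> \<le> (1 - s) * (1 - v) + v * (1 - s + s * exp 1)"
      unfolding c_def using v exp_mixture_bound[OF s, of 1]
      by (intro add_left_mono mult_left_mono) auto
    also have "\<dots> = 1 - s + s * (v * exp 1)" by (simp add: algebra_simps)
    also have "v * exp 1 = exp (t + s - 1)" by (simp add: v_def flip: exp_add)
    finally show ?thesis using True m sc by (simp add: decay_def)
  next
    case False
    then have "decay (t + s - 1) = v" by (simp add: decay_def v_def)
    then show ?thesis using exp_mixture_bound[OF s, of v] by (simp only: m sc c_def)
  qed
qed

text \<open>\<open>T / (s + T)\<close> increases with \<open>T\<close>, so the largest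
  \<open>T\<close> decides, and there \<open>exp_mixture_decay_bound\<close> applies. For
  \<open>s = 1\<close> the hypotheses force \<open>T = 0\<close>.\<close>

lemma survival_ratio_le:
  fixes s t T :: real
  assumes s: "0 < s" "s \<le> 1" and T: "0 \<le> T" "T \<le> (1 - s) * exp (- decay (max 0 (t - (1 - s))))"
  shows "T / (s + T) \<le> exp (- (s * max 1 (exp (t - 1))))"
proof (cases "s = 1")
  case True
  then show ?thesis using T by simp
next
  case False
  define b where "b = s * max 1 (exp (t - 1))"
  define d where "d = decay (max 0 (t - (1 - s)))"
  have *: "(1 - s) * exp b \<le> 1 - s + s * exp d"
    using exp_mixture_decay_bound[of s t] s False by (simp add: b_def d_def)
  have "T * exp d \<le> 1 - s"
    using T by (simp add: d_def exp_minus field_simps)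
  moreover have "exp b \<ge> 1" using s by (simp add: b_def)
  ultimately have "T * exp d * (exp b - 1) \<le> (1 - s) * (exp b - 1)"
    by (intro mult_right_mono) auto
  also have "\<dots> \<le> s * exp d" using * by (simp add: algebra_simps)
  finally have "exp d * (T * (exp b - 1)) \<le> exp d * s" by (simp add: mult_ac)
  then have "T * (exp b - 1) \<le> s" by simp
  then have "T * exp b \<le> s + T" by (simp add: algebra_simps)
  then show ?thesis unfolding b_def[symmetric]
    using s T by (simp add: exp_minus field_simps)
qed

section \<open>The dual price\<close>

text \<open>The ideal price solves \<open>price' = price - F'\<close> with \<open>F = 1 - exp (- decay y)\<close>. In the variable
  \<open>u = exp (y - 1)\<close> its tail is \<open>u\<close> times the exponential integral of \<open>u\<close>; \<open>tail_price\<close> replaces the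
  latter by \<open>exp (- u)\<close> times a rational function for which the defect of the differential equation is
  a square. The coefficient \<open>5 / 52\<close> makes \<open>price\<close> continuous at \<open>1\<close>.\<close>

definition tail_price :: "real \<Rightarrow> real" where
  "tail_price u = exp (- u) * (u * (3 * u\<^sup>2 + 16 * u + 12) / (3 * u ^ 3 + 19 * u\<^sup>2 + 25 * u + 5))"

definition price :: "real \<Rightarrow> real" where
  "price y = (if y \<le> 1 then 5 / 52 * exp (y - 2) + exp (- y) / 2 else tail_price (exp (y - 1)))"

text \<open>In the variable \<open>u = exp (y - 1)\<close> the ideal price has derivative
  \<open>tail_price u / u - exp (- u)\<close>; the last summand is the defect, and later comparisons
  rest on its sign.\<close>

lemma DERIV_tail_price:
  assumes u: "1 \<le> u"
  shows "(tail_price has_real_derivative tail_price u / u - exp (- u)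
    + exp (- u) * ((3 * u - 5) / (3 * u ^ 3 + 19 * u\<^sup>2 + 25 * u + 5))\<^sup>2) (at u)"
proof -
  define Q where "Q = 3 * u ^ 3 + 19 * u\<^sup>2 + 25 * u + 5"
  have Q: "Q > 0" unfolding Q_def using u by (intro add_pos_pos) auto
  define N where "N = u * (3 * u\<^sup>2 + 16 * u + 12)"
  define N' where "N' = 9 * u\<^sup>2 + 32 * u + 12"
  define Q' where "Q' = 9 * u\<^sup>2 + 38 * u + 25"
  have "((\<lambda>u. u * (3 * u\<^sup>2 + 16 * u + 12)) has_real_derivative N') (at u)"
    by (auto intro!: derivative_eq_intros simp: N'_def algebra_simps power2_eq_square)
  moreover have "((\<lambda>u. 3 * u ^ 3 + 19 * u\<^sup>2 + 25 * u + 5) has_real_derivative Q') (at u)"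
    by (auto intro!: derivative_eq_intros simp: Q'_def)
  ultimately have "((\<lambda>u. u * (3 * u\<^sup>2 + 16 * u + 12) / (3 * u ^ 3 + 19 * u\<^sup>2 + 25 * u + 5))
      has_real_derivative (N' * Q - N * Q') / (Q * Q)) (at u)"
    unfolding N_def Q_def by (rule DERIV_divide) (use Q in \<open>simp add: Q_def\<close>)
  moreover have "((\<lambda>u. exp (- u)) has_real_derivative - exp (- u)) (at u)"
    by (auto intro!: derivative_eq_intros)
  ultimately have "(tail_price has_real_derivative
      - exp (- u) * (N / Q) + (N' * Q - N * Q') / (Q * Q) * exp (- u)) (at u)"
    unfolding tail_price_def N_def Q_def by (intro DERIV_mult)
  then have "(tail_price has_real_derivative
      exp (- u) * ((N' * Q - N * Q') / (Q * Q)) - exp (- u) * (N / Q)) (at u)"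
    by (simp add: algebra_simps)
  moreover have "(N' * Q - N * Q') / (Q * Q) - N / Q = N / Q / u - 1 + ((3 * u - 5) / Q)\<^sup>2"
  proof -
    define P where "P = 3 * u\<^sup>2 + 16 * u + 12"
    \<comment> \<open>The coefficients of \<open>P\<close> and \<open>Q\<close> are such that
      everything beyond \<open>P * Q - Q * Q\<close> collapses to a square.\<close>
    have "N' * Q - N * Q' - N * Q = P * Q - Q * Q + (3 * u - 5)\<^sup>2"
      by (simp add: N_def N'_def P_def Q_def Q'_def power2_eq_square power3_eq_cube algebra_simps)
    then have "(N' * Q - N * Q' - N * Q) / (Q * Q)
        = (P * Q - Q * Q + (3 * u - 5)\<^sup>2) / (Q * Q)" by (simp only:)
    also have "\<dots> = P / Q - 1 + ((3 * u - 5) / Q)\<^sup>2"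
      using Q by (simp add: field_simps power2_eq_square)
    finally have "(N' * Q - N * Q' - N * Q) / (Q * Q) = P / Q - 1 + ((3 * u - 5) / Q)\<^sup>2" .
    moreover have "N / Q / u = P / Q" using u by (simp add: N_def P_def)
    ultimately show ?thesis using Q by (simp add: diff_divide_distrib)
  qed
  then have "exp (- u) * ((N' * Q - N * Q') / (Q * Q) - N / Q)
      = exp (- u) * (N / Q / u - 1 + ((3 * u - 5) / Q)\<^sup>2)" by (simp only:)
  then have "exp (- u) * ((N' * Q - N * Q') / (Q * Q)) - exp (- u) * (N / Q)
      = exp (- u) * (N / Q) / u - exp (- u) + exp (- u) * ((3 * u - 5) / Q)\<^sup>2"
    by (simp only: ring_distribs times_divide_eq_right mult_1_right)
  moreover have "tail_price u = exp (- u) * (N / Q)" by (simp add: tail_price_def N_def Q_def)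
  ultimately show ?thesis by (simp add: Q_def)
qed

text \<open>The derivative has the sign of \<open>P * Q - Q * Q + (3 * x - 5)\<^sup>2\<close>; here
  \<open>Q - P \<ge> 1\<close>, and \<open>Q\<close> alone dominates the square.\<close>

lemma tail_price_antimono:
  assumes "1 \<le> u" "u \<le> v"
  shows "tail_price v \<le> tail_price u"
proof (rule DERIV_nonpos_imp_nonincreasing[OF assms(2)])
  fix x assume "u \<le> x" "x \<le> v"
  then have x: "1 \<le> x" using assms by simp
  define P where "P = 3 * x\<^sup>2 + 16 * x + 12"
  define Q where "Q = 3 * x ^ 3 + 19 * x\<^sup>2 + 25 * x + 5"
  have pw: "x\<^sup>2 \<ge> 1" "x ^ 3 \<ge> 1" using x by auto
  have Q: "Q \<ge> 9 * x\<^sup>2 + 25" and QP: "1 \<le> Q - P"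
    unfolding Q_def P_def using pw x by linarith+
  have "(3 * x - 5)\<^sup>2 \<le> 9 * x\<^sup>2 + 25" using x by (simp add: power2_eq_square algebra_simps)
  also have "\<dots> \<le> Q * 1" using Q by simp
  also have "\<dots> \<le> Q * (Q - P)" using Q QP by (intro mult_left_mono) (auto intro: order_trans[rotated])
  finally have *: "P * Q - Q * Q + (3 * x - 5)\<^sup>2 \<le> 0" by (simp add: algebra_simps)
  have Q0: "Q > 0" using Q zero_le_power2[of x] by linarith
  have "P / Q - 1 + ((3 * x - 5) / Q)\<^sup>2 = (P * Q - Q * Q + (3 * x - 5)\<^sup>2) / (Q * Q)"
    using Q0 by (simp add: field_simps power2_eq_square)
  also have "\<dots> \<le> 0" using * Q0 by (simp add: divide_nonpos_pos)
  finally have "exp (- x) * (P / Q - 1 + ((3 * x - 5) / Q)\<^sup>2) \<le> 0"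
    by (simp add: mult_nonneg_nonpos)
  moreover have "tail_price x / x = exp (- x) * (P / Q)"
    using x by (simp add: tail_price_def P_def Q_def)
  ultimately have "tail_price x / x - exp (- x) + exp (- x) * ((3 * x - 5) / Q)\<^sup>2 \<le> 0"
    by (simp add: algebra_simps)
  then show "\<exists>y. (tail_price has_real_derivative y) (at x) \<and> y \<le> 0"
    using DERIV_tail_price[OF x] unfolding Q_def by blast
qed

text \<open>The derivative of \<open>tail_price x - exp (- x)\<close> is
  \<open>tail_price x / x\<close> plus the defect, hence at least \<open>tail_price v / x\<close>
  for \<open>x \<le> v\<close>. Logarithms turn \<open>u\<close> and \<open>v\<close> back into
  levels.\<close>

lemma tail_price_increment_ge:
  assumes "1 \<le> u" "u \<le> v"
  shows "tail_price v * (ln v - ln u) \<le> (tail_price v - exp (- v)) - (tail_price u - exp (- u))"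
proof -
  define f where "f x = tail_price x - exp (- x) - tail_price v * ln x" for x
  have "f u \<le> f v"
  proof (rule DERIV_nonneg_imp_nondecreasing[OF assms(2)])
    fix x assume ux: "u \<le> x" "x \<le> v"
    then have x: "1 \<le> x" using assms by simp
    define r where "r = exp (- x) * ((3 * x - 5) / (3 * x ^ 3 + 19 * x\<^sup>2 + 25 * x + 5))\<^sup>2"
    have "(f has_real_derivative tail_price x / x - tail_price v / x + r) (at x)"
      unfolding f_def using x
      by (auto intro!: derivative_eq_intros DERIV_tail_price[OF x] simp: r_def)
    moreover have "r \<ge> 0" by (simp add: r_def)
    moreover have "tail_price v / x \<le> tail_price x / x"
      using tail_price_antimono[OF x ux(2)] x by (intro divide_right_mono) auto
    ultimately show "\<exists>y. (f has_real_derivative y) (at x) \<and> 0 \<le> y"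
      by (intro exI[of _ "tail_price x / x - tail_price v / x + r"]) auto
  qed
  then show ?thesis by (simp add: f_def algebra_simps)
qed

lemma price_eq_tail: "1 \<le> y \<Longrightarrow> price y = tail_price (exp (y - 1))"
proof -
  have "5 / 52 * exp (1 - 2) + exp (- 1) / 2 = tail_price 1"
    by (simp add: tail_price_def)
  then show "1 \<le> y \<Longrightarrow> ?thesis" by (cases "y = 1") (auto simp: price_def)
qed

lemma price_nonneg: "0 \<le> price y"
proof (cases "y \<le> 1")
  case False
  then show ?thesis unfolding price_def tail_price_def by (simp add: add_nonneg_nonneg)
qed (simp add: price_def)

lemma price_antimono:
  assumes "y \<le> z"
  shows "price z \<le> price y"
proof -
  have upper: "price b \<le> price a" if "1 \<le> a" "a \<le> b" for a b
    using that tail_price_antimono[of "exp (a - 1)" "exp (b - 1)"] by (simp add: price_eq_tail)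
  have lower: "price b \<le> price a" if "a \<le> b" "b \<le> 1" for a b
  proof -
    have "5 / 52 * exp (b - 2) + exp (- b) / 2 \<le> 5 / 52 * exp (a - 2) + exp (- a) / 2"
    proof (rule DERIV_nonpos_imp_nonincreasing[OF that(1)])
      fix x assume x: "a \<le> x" "x \<le> b"
      have "((\<lambda>x. 5 / 52 * exp (x - 2) + exp (- x) / 2) has_real_derivative
          5 / 52 * exp (x - 2) - exp (- x) / 2) (at x)"
        by (auto intro!: derivative_eq_intros)
      \<comment> \<open>\<open>x \<le> 1\<close> gives \<open>x - 2 \<le> - x\<close>.\<close>
      moreover have "5 / 52 * exp (x - 2) \<le> 1 / 2 * exp (- x)"
        using x that by (intro mult_mono) auto
      ultimately show "\<exists>y. ((\<lambda>x. 5 / 52 * exp (x - 2) + exp (- x) / 2) has_real_derivative y)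
          (at x) \<and> y \<le> 0" by (intro exI[of _ "5 / 52 * exp (x - 2) - exp (- x) / 2"]) auto
    qed
    then show ?thesis using that by (simp add: price_def)
  qed
  show ?thesis using assms upper[of y z] upper[of 1 z] lower[of y z] lower[of y 1] by linarith
qed


text \<open>The dual constraint of a single offline vertex filled up to the threshold
  \<open>z\<close>. The derivative of \<open>price y - exp (- decay y)\<close> equals
  \<open>price y\<close> below level 1 and is at least \<open>price y\<close> above it, and
  \<open>price\<close> decreases.\<close>

lemma price_increment_ge:
  assumes "0 \<le> y" "y \<le> z"
  shows "price z * (z - y)
    \<le> (price z - exp (- decay z)) - (price y - exp (- decay y))"
proof -
  define H where "H x = price x - exp (- decay x)" for x
  have upper: "price b * (b - a) \<le> H b - H a" if "1 \<le> a" "a \<le> b" for a b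
  proof -
    have "decay x = exp (x - 1)" if "1 \<le> x" for x
      using that by (cases "x = 1") (auto simp: decay_def)
    then show ?thesis
      using that tail_price_increment_ge[of "exp (a - 1)" "exp (b - 1)"]
      by (simp add: H_def price_eq_tail)
  qed
  have lower: "price b * (b - a) \<le> H b - H a" if "a \<le> b" "b \<le> 1" for a b
  proof -
    define h where "h x = 5 / 52 * exp (x - 2) - exp (- x) / 2 - price b * x" for x
    have "h a \<le> h b"
    proof (rule DERIV_nonneg_imp_nondecreasing[OF that(1), where f = h])
      fix x assume x: "a \<le> x" "x \<le> b"
      have "(h has_real_derivative price x - price b) (at x)"
        unfolding h_def using x that by (auto intro!: derivative_eq_intros simp: price_def)
      moreover have "price b \<le> price x" using x by (intro price_antimono)
      ultimately show "\<exists>y. (h has_real_derivative y) (at x) \<and> 0 \<le> y" by fastforce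
    qed
    moreover have "H a = 5 / 52 * exp (a - 2) - exp (- a) / 2"
      "H b = 5 / 52 * exp (b - 2) - exp (- b) / 2"
      using that by (simp_all add: H_def decay_def price_def)
    ultimately show ?thesis by (simp add: h_def algebra_simps)
  qed
  have "price z * (z - y) \<le> H z - H y"
  proof -
    consider "1 \<le> y" | "z \<le> 1" | "y \<le> 1" "1 \<le> z" by linarith
    then show ?thesis
    proof cases
      case 3
      have "price z * (1 - y) \<le> price 1 * (1 - y)"
        using 3 by (intro mult_right_mono price_antimono) auto
      then show ?thesis using lower[of y 1] upper[of 1 z] 3 by (simp add: algebra_simps)
    qed (use assms upper lower in auto)
  qed
  then show ?thesis by (simp add: H_def)
qed

text \<open>\<open>price 0\<close> is \<open>1 / 2 + 5 / 52 * exp (- 2)\<close>, which exceeds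
  \<open>0.513\<close> by only about \<open>0.00001\<close>; the bound \<open>2.72\<close> on
  \<open>exp 1\<close> would be too coarse.\<close>

lemma price_0_ge: "0.513 \<le> price 0"
proof -
  have "exp 1 \<le> (2.719 :: real)"
    using e_approx_32 by (simp add: abs_if split: if_split_asm)
  then have "exp 1 * exp 1 \<le> (2.719 * 2.719 :: real)" by (intro mult_mono) auto
  then have "exp 2 \<le> (2.719 * 2.719 :: real)" by (simp flip: exp_add)
  then have "(0.013 :: real) * exp 2 \<le> 5 / 52" by simp
  then have "(0.013 :: real) \<le> 5 / 52 * exp (- 2)" by (simp add: exp_minus field_simps)
  then show ?thesis by (simp add: price_def)
qed

section \<open>Survival of a set of offline vertices\<close>

lemma balance_alloc_nonneg: "0 \<le> balance_alloc y N j"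
  by (simp add: balance_alloc_def)

lemma balance_alloc_level: "0 < balance_alloc y N j \<Longrightarrow> y j + balance_alloc y N j = threshold y N"
  by (auto simp: balance_alloc_def max_def split: if_splits)

lemma sum_balance_alloc:
  assumes "finite N" "N \<noteq> {}" "\<And>j. j \<in> N \<Longrightarrow> 0 \<le> y j"
  shows "sum (balance_alloc y N) N = 1"
proof -
  have "(\<Sum>j\<in>N. max (threshold y N - y j) 0) = 1"
    using theI'[OF threshold_ex1[of N y]] assms unfolding threshold_def by blast
  then show ?thesis by (simp add: balance_alloc_def)
qed

text \<open>The left side is the factor by which one arrival shrinks the survival bound of
  \<open>A\<close>. A neighbor outside \<open>A\<close> receives at most \<open>1 - s\<close>, so if
  it receives anything it started at \<open>t - (1 - s)\<close> or higher. Vertices of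
  \<open>A\<close> that receive mass end at \<open>t\<close>, where the slope of
  \<open>decay\<close> is largest.\<close>

lemma balance_alloc_survival:
  fixes y :: "'b \<Rightarrow> real"
  assumes N: "finite N" and A: "finite A" and y: "\<And>j. 0 \<le> y j"
  defines "x \<equiv> balance_alloc y N"
  defines "T \<equiv> \<Sum>k\<in>N - A. x k * exp (- decay (y k))"
  assumes s: "0 < sum x A"
  shows "T / (sum x A + T) \<le> exp (- (\<Sum>j\<in>A. decay (y j + x j) - decay (y j)))"
proof -
  define s where "s = sum x A"
  define t where "t = threshold y N"
  have x0: "0 \<le> x j" for j by (simp add: x_def balance_alloc_nonneg)
  have lev: "y j + x j = t" if "0 < x j" for j
    using that unfolding x_def t_def by (rule balance_alloc_level)
  have out: "x j = 0" if "j \<notin> N" for j using that by (simp add: x_def balance_alloc_def)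
  have "N \<noteq> {}" using s out by force
  then have tot: "sum x N = 1" unfolding x_def using N y by (intro sum_balance_alloc)
  have "sum x A = sum x (N \<inter> A)"
    using A out by (intro sum.mono_neutral_right) auto
  then have rest: "sum x (N - A) = 1 - s"
    using tot sum.Int_Diff[OF N, of x A] by (simp add: s_def)
  have "0 \<le> sum x (N - A)" by (intro sum_nonneg x0)
  then have s1: "0 < s" "s \<le> 1" using s rest by (auto simp: s_def)
  have T0: "0 \<le> T" unfolding T_def by (intro sum_nonneg mult_nonneg_nonneg x0) auto
  have "T \<le> (\<Sum>k\<in>N - A. x k * exp (- decay (max 0 (t - (1 - s)))))"
    unfolding T_def
  proof (intro sum_mono)
    fix k assume k: "k \<in> N - A"
    show "x k * exp (- decay (y k)) \<le> x k * exp (- decay (max 0 (t - (1 - s))))"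
    proof (cases "0 < x k")
      case True
      have "x k \<le> 1 - s" unfolding rest[symmetric]
        using k N x0 by (intro member_le_sum) auto
      then have "max 0 (t - (1 - s)) \<le> y k" using lev[OF True] y[of k] by simp
      then show ?thesis using True by (simp add: decay_mono)
    qed (use x0[of k] in simp)
  qed
  also have "\<dots> = (1 - s) * exp (- decay (max 0 (t - (1 - s))))"
    by (simp only: rest flip: sum_distrib_right)
  finally have ratio: "T / (s + T) \<le> exp (- (s * max 1 (exp (t - 1))))"
    using s1 T0 by (intro survival_ratio_le)
  have "(\<Sum>j\<in>A. decay (y j + x j) - decay (y j)) \<le> (\<Sum>j\<in>A. x j * max 1 (exp (t - 1)))"
  proof (intro sum_mono)
    fix j
    show "decay (y j + x j) - decay (y j) \<le> x j * max 1 (exp (t - 1))"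
    proof (cases "0 < x j")
      case True
      then show ?thesis using decay_increment_le[of "y j" "y j + x j"]
        by (simp add: lev[OF True, symmetric] mult.commute)
    qed (use x0[of j] in simp)
  qed
  then have "exp (- (s * max 1 (exp (t - 1)))) \<le> exp (- (\<Sum>j\<in>A. decay (y j + x j) - decay (y j)))"
    by (simp add: s_def sum_distrib_right)
  with ratio show ?thesis unfolding s_def by (rule order_trans)
qed

section \<open>Survival through one random arrival, and induction over the arrivals\<close>

lemma measure_pmf_prob_bind:
  "measure_pmf.prob (bind_pmf p f) A = measure_pmf.expectation p (\<lambda>x. measure_pmf.prob (f x) A)"
proof -
  have int: "integrable (measure_pmf p) (\<lambda>x. measure_pmf.prob (f x) A)"
    by (rule measure_pmf.integrable_const_bound[where B = 1]) auto
  have "ennreal (measure_pmf.prob (bind_pmf p f) A)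
      = (\<integral>\<^sup>+ x. ennreal (measure_pmf.prob (f x) A) \<partial>measure_pmf p)"
    by (simp flip: measure_pmf.emeasure_eq_measure)
  also have "\<dots> = ennreal (measure_pmf.expectation p (\<lambda>x. measure_pmf.prob (f x) A))"
    using int by (intro nn_integral_eq_integral) auto
  finally show ?thesis by (simp add: integral_nonneg_AE)
qed

definition free_event :: "'b set \<Rightarrow> (nat \<times> 'b) set set" where
  "free_event S = {M. S \<inter> snd ` M = {}}"

text \<open>If \<open>S\<close> is free, the arrival hits it with probability
  \<open>s / (s + X)\<close>, where \<open>X\<close> is the mass of the unmatched neighbors outside
  \<open>S\<close>. A tangent at \<open>T\<close> makes the bound linear in the indicators, so it
  can be averaged over \<open>M\<close> term by term.\<close>

lemma swor_step_bound:
  fixes E :: "(nat \<times> 'b) set"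
  assumes fin: "finite (neighbors E i)" and S: "finite S"
    and K: "let U = unmatched_neighbors E i M in
     if \<exists>j\<in>U. balance_x E i j > 0
     then \<forall>j\<in>U. pmf q (Some j) = balance_x E i j / (\<Sum>k\<in>U. balance_x E i k)
     else set_pmf q \<subseteq> insert None (Some ` U)"
    and s: "0 < sum (balance_x E i) S" and T: "0 \<le> T"
  defines "x \<equiv> balance_x E i"
  shows "measure_pmf.prob (map_pmf (\<lambda>c. case c of None \<Rightarrow> M | Some j \<Rightarrow> insert (i, j) M) q) (free_event S)
    \<le> (T\<^sup>2 * indicator (free_event S) M
        + sum x S * (\<Sum>k\<in>neighbors E i - S. x k * indicator (free_event (insert k S)) M)) / (sum x S + T)\<^sup>2"
    (is "?L \<le> ?R")
proof -
  have x0: "0 \<le> x j" for j by (simp add: x_def balance_x_def balance_alloc_nonneg)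
  define s where "s = sum x S"
  have s0: "0 < s" using s by (simp add: s_def x_def)
  let ?f = "\<lambda>c. case c of None \<Rightarrow> M | Some j \<Rightarrow> insert (i, j) M"
  show ?thesis
  proof (cases "M \<in> free_event S")
    case False
    then have "?f -` free_event S = {}"
      by (auto simp: free_event_def split: option.splits)
    then have "?L = 0" by (simp add: measure_map_pmf)
    moreover have "0 \<le> ?R"
      using x0 s0 by (intro divide_nonneg_nonneg add_nonneg_nonneg mult_nonneg_nonneg sum_nonneg)
        (auto simp: s_def)
    ultimately show ?thesis by simp
  next
    case True
    define N where "N = neighbors E i"
    define U where "U = unmatched_neighbors E i M"
    define X where "X = (\<Sum>k\<in>N - S. x k * indicator (free_event (insert k S)) M)"
    have out: "x j = 0" if "j \<notin> N" for j
      using that by (simp add: x_def N_def balance_x_def balance_alloc_def)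
    have finN: "finite N" using fin by (simp add: N_def)
    then have finU: "finite U" by (auto simp: U_def N_def unmatched_neighbors_def)
    have SU: "N \<inter> S \<subseteq> U" using True by (auto simp: U_def N_def unmatched_neighbors_def free_event_def)
    have sS: "s = sum x (N \<inter> S)" unfolding s_def
      using S out by (intro sum.mono_neutral_right) auto
    have "X = (\<Sum>k\<in>U - S. x k)"
      unfolding X_def using True finN
      by (intro sum.mono_neutral_cong_right)
        (auto simp: U_def N_def unmatched_neighbors_def free_event_def indicator_def)
    moreover have "U \<inter> S = N \<inter> S" using SU by (auto simp: U_def N_def unmatched_neighbors_def)
    ultimately have sU: "sum x U = s + X"
      using sum.Int_Diff[OF finU, of x S] sS by simp
    have X0: "0 \<le> X" unfolding X_def by (intro sum_nonneg mult_nonneg_nonneg x0) auto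
    \<comment> \<open>The positive mass \<open>s\<close> lies on unmatched neighbors, so the arrival
      is not degenerate and has the prescribed probabilities.\<close>
    have "\<exists>j\<in>U. 0 < x j"
    proof (rule ccontr)
      assume "\<not> ?thesis"
      then have "sum x (N \<inter> S) \<le> 0" using SU by (intro sum_nonpos) force
      then show False using s0 sS by simp
    qed
    then have pm: "pmf q (Some j) = x j / (s + X)" if "j \<in> U" for j
      using K that unfolding Let_def U_def[symmetric] x_def[symmetric] sU by auto
    have "measure_pmf.prob q (Some ` (N \<inter> S)) = (\<Sum>c\<in>Some ` (N \<inter> S). pmf q c)"
      using finN by (intro measure_measure_pmf_finite) auto
    also have "\<dots> = (\<Sum>j\<in>N \<inter> S. pmf q (Some j))" by (simp add: sum.reindex)
    also have "\<dots> = (\<Sum>j\<in>N \<inter> S. x j / (s + X))" using SU pm by (intro sum.cong) auto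
    also have "\<dots> = s / (s + X)" by (simp add: sS sum_divide_distrib)
    finally have hit: "measure_pmf.prob q (Some ` (N \<inter> S)) = s / (s + X)" .
    have "?L = measure_pmf.prob q (?f -` free_event S)" by (simp add: measure_map_pmf)
    also have "\<dots> \<le> measure_pmf.prob q (UNIV - Some ` (N \<inter> S))"
      by (intro measure_pmf.finite_measure_mono) (auto simp: free_event_def)
    also have "\<dots> = 1 - s / (s + X)"
      using measure_pmf.prob_compl[of "Some ` (N \<inter> S)" q] hit by simp
    also have "\<dots> = X / (s + X)" using s0 X0 by (simp add: field_simps)
    also have "\<dots> \<le> (T\<^sup>2 + s * X) / (s + T)\<^sup>2"
    proof -
      \<comment> \<open>the tangent at \<open>T\<close> of the concave function \<open>X / (s + X)\<close>\<close>
      have "(T\<^sup>2 + s * X) * (s + X) - X * (s + T)\<^sup>2 = s * (T - X)\<^sup>2"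
        by (simp add: power2_eq_square algebra_simps)
      moreover have "0 \<le> s * (T - X)\<^sup>2" using s0 by simp
      ultimately have "X * (s + T)\<^sup>2 \<le> (T\<^sup>2 + s * X) * (s + X)" by linarith
      then show ?thesis using s0 X0 T by (simp add: divide_le_eq le_divide_eq mult.commute)
    qed
    finally show ?thesis using True by (simp add: s_def X_def N_def)
  qed
qed

text \<open>The set stays arbitrary in the induction because the step for \<open>S\<close> also uses
  the hypothesis for \<open>insert k S\<close>.\<close>

lemma prob_free_le:
  fixes E :: "(nat \<times> 'b) set"
  assumes G: "online_bipartite_graph n J E" and K: "balance_swor n E K"
    and "i \<le> n" "finite S"
  shows "measure_pmf.prob (matching_after K i) (free_event S)
    \<le> exp (- (\<Sum>j\<in>S. decay (balance_y E i j)))"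
  using assms(3,4)
proof (induction i arbitrary: S)
  case 0
  then show ?case by (simp add: decay_def)
next
  case (Suc i)
  let ?p = "matching_after K i"
  define y where "y = balance_y E i"
  define N where "N = neighbors E (Suc i)"
  define x where "x = balance_alloc y N"
  define step where "step M = map_pmf (\<lambda>c. case c of None \<Rightarrow> M | Some j \<Rightarrow> insert (Suc i, j) M)
    (K (Suc i) M)" for M
  define pr where "pr S = measure_pmf.prob ?p (free_event S)" for S
  define D where "D S = exp (- (\<Sum>j\<in>S. decay (y j)))" for S
  have IH: "pr S \<le> D S" if "finite S" for S
    using Suc.IH[OF _ that] Suc.prems by (simp add: pr_def D_def y_def)
  have x: "balance_x E (Suc i) = x" by (simp add: balance_x_def x_def y_def N_def)
  have y': "balance_y E (Suc i) j = y j + x j" for j by (simp add: x_def y_def N_def)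
  have y0: "0 \<le> y j" for j by (simp add: y_def balance_y_nonneg)
  have x0: "0 \<le> x j" for j by (simp add: x_def balance_alloc_nonneg)
  have finN: "finite N"
    using G by (auto simp: N_def neighbors_def online_bipartite_graph_def intro: finite_subset[of _ J])
  have ev: "measure_pmf.expectation ?p (indicator (free_event S)) = pr S" for S
    by (simp add: pr_def)
  have int: "integrable (measure_pmf ?p) (indicator (free_event S) :: _ \<Rightarrow> real)" for S
    by (rule measure_pmf.integrable_const_bound[where B = 1]) auto
  have int': "integrable (measure_pmf ?p) (\<lambda>M. measure_pmf.prob (step M) (free_event S))"
    by (rule measure_pmf.integrable_const_bound[where B = 1]) auto
  have L: "measure_pmf.prob (matching_after K (Suc i)) (free_event S)
      = measure_pmf.expectation ?p (\<lambda>M. measure_pmf.prob (step M) (free_event S))" (is "?L = _")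
    by (simp add: measure_pmf_prob_bind step_def)
  show ?case
  proof (cases "0 < sum x S")
    case False
    \<comment> \<open>The levels of \<open>S\<close> do not move, and the event that
      \<open>S\<close> is free can only shrink, however the arrival is matched.\<close>
    then have "sum x S = 0" using x0 by (simp add: sum_nonneg order_antisym not_less)
    then have xS: "x j = 0" if "j \<in> S" for j
      using that x0 \<open>finite S\<close> by (simp add: sum_nonneg_eq_0_iff)
    have "?L \<le> measure_pmf.expectation ?p (indicator (free_event S))"
      unfolding L
    proof (intro integral_mono int int')
      fix M
      show "measure_pmf.prob (step M) (free_event S) \<le> indicator (free_event S) M"
      proof (cases "M \<in> free_event S")
        case False
        then have "(\<lambda>c. case c of None \<Rightarrow> M | Some j \<Rightarrow> insert (Suc i, j) M) -` free_event S = {}"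
          by (auto simp: free_event_def split: option.splits)
        then show ?thesis by (simp add: step_def measure_map_pmf)
      qed simp
    qed
    also have "\<dots> \<le> D S" using IH[OF \<open>finite S\<close>] ev by simp
    also have "D S = exp (- (\<Sum>j\<in>S. decay (y j + x j)))" by (simp add: D_def xS)
    finally show ?thesis by (simp only: y')
  next
    case True
    define s where "s = sum x S"
    \<comment> \<open>The point of tangency is the bound that the induction hypothesis gives for the
      expected mass outside \<open>S\<close>, divided by \<open>D S\<close>; with it the averaged
      tangent collapses to \<open>D S * (T / (s + T))\<close>.\<close>
    define T where "T = (\<Sum>k\<in>N - S. x k * exp (- decay (y k)))"
    have s0: "0 < s" using True by (simp add: s_def)
    have T0: "0 \<le> T" unfolding T_def by (intro sum_nonneg mult_nonneg_nonneg x0) auto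
    define R where "R M = (T\<^sup>2 * indicator (free_event S) M
        + s * (\<Sum>k\<in>N - S. x k * indicator (free_event (insert k S)) M)) / (s + T)\<^sup>2" for M
    have "?L \<le> measure_pmf.expectation ?p R"
      unfolding L
    proof (intro integral_mono int')
      show "integrable (measure_pmf ?p) R"
        unfolding R_def using int by auto
      fix M
      have "Suc i \<in> {1..n}" using Suc.prems by simp
      note KM = spec[OF bspec[OF K[unfolded balance_swor_def] this]]
      show "measure_pmf.prob (step M) (free_event S) \<le> R M"
        unfolding R_def step_def s_def N_def x[symmetric]
        by (intro swor_step_bound finN[unfolded N_def] \<open>finite S\<close> T0 KM)
          (use True x in simp)
    qed
    also have "\<dots> = (T\<^sup>2 * pr S + s * (\<Sum>k\<in>N - S. x k * pr (insert k S))) / (s + T)\<^sup>2"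
      unfolding R_def using int by (simp add: pr_def)
    also have "\<dots> \<le> (T\<^sup>2 * D S + s * (\<Sum>k\<in>N - S. x k * D (insert k S))) / (s + T)\<^sup>2"
      using s0 \<open>finite S\<close> x0
      by (intro divide_right_mono add_mono mult_left_mono sum_mono IH) auto
    also have "(\<Sum>k\<in>N - S. x k * D (insert k S)) = D S * T"
      unfolding T_def D_def sum_distrib_left using \<open>finite S\<close>
      by (intro sum.cong) (auto simp: mult_ac simp flip: exp_add)
    also have "(T\<^sup>2 * D S + s * (D S * T)) / (s + T)\<^sup>2 = D S * (T / (s + T))"
      using s0 T0 by (simp add: power2_eq_square divide_simps) (simp add: algebra_simps)
    also have "\<dots> \<le> D S * exp (- (\<Sum>j\<in>S. decay (y j + x j) - decay (y j)))"
      using balance_alloc_survival[OF finN \<open>finite S\<close>, of y] y0 True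
      by (intro mult_left_mono) (auto simp: s_def T_def x_def D_def)
    also have "\<dots> = exp (- (\<Sum>j\<in>S. decay (y j + x j)))"
      by (simp add: D_def sum_subtractf flip: exp_add)
    finally show ?thesis by (simp only: y')
  qed
qed

section \<open>Expected size and the primal-dual argument\<close>

text \<open>The cardinality bound serves to make the matching size integrable.\<close>

lemma set_pmf_matching_after:
  "M \<in> set_pmf (matching_after K i) \<Longrightarrow> finite M \<and> card M \<le> i"
proof (induction i arbitrary: M)
  case (Suc i)
  then obtain M' c where M': "M' \<in> set_pmf (matching_after K i)"
    and M: "M = (case c of None \<Rightarrow> M' | Some j \<Rightarrow> insert (Suc i, j) M')"
    by auto
  show ?case using Suc.IH[OF M'] M by (auto split: option.splits simp: card_insert_if)
qed simp

text \<open>Every outcome has at least as many edges as covered offline vertices; linearity of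
  expectation does the rest.\<close>

lemma expected_size_ge:
  assumes J: "finite J"
  shows "(\<Sum>j\<in>J. 1 - measure_pmf.prob (matching_after K i) (free_event {j}))
    \<le> measure_pmf.expectation (matching_after K i) (\<lambda>M. real (card M))"
proof -
  let ?p = "matching_after K i"
  have int: "integrable (measure_pmf ?p) (indicator (free_event S) :: _ \<Rightarrow> real)" for S
    by (rule measure_pmf.integrable_const_bound[where B = 1]) auto
  have "(\<Sum>j\<in>J. 1 - measure_pmf.prob ?p (free_event {j}))
      = measure_pmf.expectation ?p (\<lambda>M. \<Sum>j\<in>J. 1 - indicator (free_event {j}) M)"
    using int by (subst Bochner_Integration.integral_sum) auto
  also have "\<dots> \<le> measure_pmf.expectation ?p (\<lambda>M. real (card M))"
  proof (rule integral_mono_AE)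
    show "integrable (measure_pmf ?p) (\<lambda>M. \<Sum>j\<in>J. 1 - indicator (free_event {j}) M :: real)"
      using int by auto
    show "integrable (measure_pmf ?p) (\<lambda>M. real (card M))"
      by (rule measure_pmf.integrable_const_bound[where B = i])
        (auto simp: AE_measure_pmf_iff set_pmf_matching_after)
    show "AE M in measure_pmf ?p. (\<Sum>j\<in>J. 1 - indicator (free_event {j}) M) \<le> real (card M)"
    proof (rule AE_pmfI)
      fix M assume "M \<in> set_pmf ?p"
      then have M: "finite M" by (simp add: set_pmf_matching_after)
      have "(\<Sum>j\<in>J. 1 - indicator (free_event {j}) M) = (\<Sum>j\<in>J. if j \<in> snd ` M then 1 else 0 :: real)"
        by (intro sum.cong) (auto simp: free_event_def indicator_def)
      also have "\<dots> = real (card (J \<inter> snd ` M))" using J by (simp add: sum.If_cases)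
      also have "\<dots> \<le> real (card (snd ` M))" using M by (intro of_nat_mono card_mono) auto
      also have "\<dots> \<le> real (card M)" using M by (intro of_nat_mono card_image_le)
      finally show "(\<Sum>j\<in>J. 1 - indicator (free_event {j}) M) \<le> real (card M)" .
    qed
  qed
  finally show ?thesis .
qed

section \<open>Prices as a dual solution\<close>

definition balance_threshold :: "(nat \<times> 'b) set \<Rightarrow> nat \<Rightarrow> real" where
  "balance_threshold E i = threshold (balance_y E (i - 1)) (neighbors E i)"

text \<open>Up to its value at level 0, this is the share of \<open>1 - exp (- decay y)\<close> left
  for online vertices once the offline vertex has been paid
  \<open>price 0 - price y\<close>.\<close>

definition level_potential :: "real \<Rightarrow> real" where
  "level_potential y = price y - exp (- decay y)"

text \<open>An arrival with neighbors spreads exactly one unit, and each vertex that gets a part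
  ends at the threshold \<open>t\<close>, so by \<open>price_increment_ge\<close> the potentials
  grow by at least \<open>price t\<close>. Isolated vertices are left out, as their threshold is
  unspecified.\<close>

lemma sum_price_threshold_le:
  fixes E :: "(nat \<times> 'b) set"
  assumes G: "online_bipartite_graph n J E" and "i \<le> n"
  shows "(\<Sum>k | k \<in> {1..i} \<and> neighbors E k \<noteq> {}. price (balance_threshold E k))
    \<le> (\<Sum>j\<in>J. level_potential (balance_y E i j) - level_potential 0)"
  using assms(2)
proof (induction i)
  case (Suc i)
  define y where "y = balance_y E i"
  define N where "N = neighbors E (Suc i)"
  define x where "x = balance_alloc y N"
  define t where "t = threshold y N"
  have J: "finite J" "N \<subseteq> J"
    using G by (auto simp: N_def neighbors_def online_bipartite_graph_def)
  have y0: "0 \<le> y j" for j by (simp add: y_def balance_y_nonneg)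
  have x0: "0 \<le> x j" for j by (simp add: x_def balance_alloc_nonneg)
  have "price t * x j \<le> level_potential (y j + x j) - level_potential (y j)" for j
  proof (cases "0 < x j")
    case True
    then have "y j + x j = t" unfolding x_def t_def by (rule balance_alloc_level)
    then have "y j \<le> t" "t - y j = x j" "t = y j + x j" using x0[of j] by linarith+
    then show ?thesis using price_increment_ge[OF y0, of j t] by (simp only: level_potential_def)
  qed (use x0[of j] in simp)
  then have "price t * sum x J
      \<le> (\<Sum>j\<in>J. level_potential (y j + x j) - level_potential (y j))"
    unfolding sum_distrib_left by (intro sum_mono)
  moreover have "sum x J = (if N = {} then 0 else 1)"
  proof -
    have "sum x J = sum x N"
      using J by (intro sum.mono_neutral_right) (auto simp: x_def balance_alloc_def)
    then show ?thesis
      using sum_balance_alloc[of N y] J y0 by (auto simp: x_def dest: finite_subset)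
  qed
  moreover have "{k. k \<in> {1..Suc i} \<and> neighbors E k \<noteq> {}}
      = (if N = {} then {} else {Suc i}) \<union> {k. k \<in> {1..i} \<and> neighbors E k \<noteq> {}}"
    by (auto simp: N_def le_Suc_eq)
  then have "(\<Sum>k | k \<in> {1..Suc i} \<and> neighbors E k \<noteq> {}. price (balance_threshold E k))
      = (if N = {} then 0 else price t)
        + (\<Sum>k | k \<in> {1..i} \<and> neighbors E k \<noteq> {}. price (balance_threshold E k))"
    by (simp add: sum.union_disjoint balance_threshold_def t_def y_def N_def)
  moreover have "balance_y E (Suc i) j = y j + x j" for j by (simp add: x_def y_def N_def)
  moreover have "(\<Sum>k | k \<in> {1..i} \<and> neighbors E k \<noteq> {}. price (balance_threshold E k))
      \<le> (\<Sum>j\<in>J. level_potential (y j) - level_potential 0)"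
    using Suc by (simp add: y_def)
  ultimately show ?case by (simp add: sum_subtractf split: if_splits)
qed simp

lemma balance_y_mono: "i \<le> k \<Longrightarrow> balance_y E i j \<le> balance_y E k j"
  by (rule lift_Suc_mono_le[of "\<lambda>i. balance_y E i j"]) (simp_all add: balance_alloc_nonneg)

text \<open>Water filling lifts every neighbor at least to the threshold, and levels never
  fall.\<close>

lemma balance_threshold_le_level:
  assumes "(i, j) \<in> E" "1 \<le> i" "i \<le> n"
  shows "balance_threshold E i \<le> balance_y E n j"
proof -
  obtain m where m: "i = Suc m" using assms(2) by (cases i) auto
  have "balance_threshold E i \<le> balance_y E i j"
    using assms(1) by (simp add: m balance_threshold_def balance_alloc_def neighbors_def)
  also have "\<dots> \<le> balance_y E n j" using assms(3) by (rule balance_y_mono)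
  finally show ?thesis .
qed

text \<open>Weak duality: an edge of \<open>M\<close> whose offline end has final level
  \<open>z\<close> collects at least \<open>price z\<close> from its online end and
  \<open>price 0 - price z\<close> from its offline end.\<close>

lemma fractional_value_ge:
  fixes E :: "(nat \<times> 'b) set"
  assumes G: "online_bipartite_graph n J E" and M: "matching E M"
  shows "price 0 * card M \<le> (\<Sum>j\<in>J. 1 - exp (- decay (balance_y E n j)))"
proof -
  let ?y = "balance_y E n"
  have J: "finite J" and E: "E \<subseteq> {1..n} \<times> J"
    using G by (auto simp: online_bipartite_graph_def)
  have ME: "M \<subseteq> E" and inj: "inj_on fst M" "inj_on snd M" using M by (auto simp: matching_def)
  have MJ: "snd ` M \<subseteq> J" using ME E by auto
  have "(\<Sum>j\<in>snd ` M. price (?y j)) = (\<Sum>e\<in>M. price (?y (snd e)))"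
    using inj by (simp add: sum.reindex)
  also have "\<dots> \<le> (\<Sum>e\<in>M. price (balance_threshold E (fst e)))"
    using ME E by (intro sum_mono price_antimono balance_threshold_le_level) auto
  also have "\<dots> = (\<Sum>k\<in>fst ` M. price (balance_threshold E k))"
    using inj by (simp add: sum.reindex)
  \<comment> \<open>Prices are nonnegative, so the online vertices outside \<open>M\<close> may be
    added.\<close>
  also have "\<dots> \<le> (\<Sum>k | k \<in> {1..n} \<and> neighbors E k \<noteq> {}. price (balance_threshold E k))"
    using ME E by (intro sum_mono2) (auto simp: neighbors_def price_nonneg, blast)
  also have "\<dots> \<le> (\<Sum>j\<in>J. level_potential (?y j) - level_potential 0)"
    by (rule sum_price_threshold_le[OF G order_refl])
  finally have gain: "(\<Sum>j\<in>snd ` M. price (?y j))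
      \<le> (\<Sum>j\<in>J. level_potential (?y j) - level_potential 0)" .
  have "(\<Sum>j\<in>snd ` M. price 0 - price (?y j)) \<le> (\<Sum>j\<in>J. price 0 - price (?y j))"
    using J MJ by (intro sum_mono2) (auto intro: price_antimono balance_y_nonneg)
  moreover have "card M = card (snd ` M)" using inj by (simp add: card_image)
  moreover have "1 - exp (- decay z)
      = (level_potential z - level_potential 0) + (price 0 - price z)" for z
    by (simp add: level_potential_def decay_def)
  ultimately show ?thesis using gain by (simp add: sum.distrib sum_subtractf mult.commute)
qed

theorem mainTheorem1:
  fixes n :: nat and J :: "'b set" and E :: "(nat \<times> 'b) set"
    and K :: "nat \<Rightarrow> (nat \<times> 'b) set \<Rightarrow> 'b option pmf"
  assumes "online_bipartite_graph n J E"
    and "balance_swor n E K"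
  shows "measure_pmf.expectation (matching_after K n) (\<lambda>M. real (card M))
           \<ge> 0.513 * real (max_matching_size E)"
proof -
  have J: "finite J" and "E \<subseteq> {1..n} \<times> J"
    using assms(1) by (auto simp: online_bipartite_graph_def)
  then have "finite E" by (auto intro: finite_subset)
  then have "finite {M. matching E M}"
    by (auto intro: finite_subset[of _ "Pow E"] simp: matching_def)
  moreover have "matching E {}" by (simp add: matching_def)
  ultimately have "max_matching_size E \<in> card ` {M. matching E M}"
    unfolding max_matching_size_def by (intro Max_in) auto
  then obtain M where M: "matching E M" "max_matching_size E = card M" by auto
  have "0.513 * real (max_matching_size E) \<le> price 0 * card M"
    unfolding M(2) by (intro mult_right_mono price_0_ge) simp
  also have "\<dots> \<le> (\<Sum>j\<in>J. 1 - exp (- decay (balance_y E n j)))"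
    by (rule fractional_value_ge[OF assms(1) M(1)])
  also have "\<dots> \<le> (\<Sum>j\<in>J. 1 - measure_pmf.prob (matching_after K n) (free_event {j}))"
    using prob_free_le[OF assms order_refl, of "{j}" for j] by (intro sum_mono) simp
  also have "\<dots> \<le> measure_pmf.expectation (matching_after K n) (\<lambda>M. real (card M))"
    by (rule expected_size_ge[OF J])
  finally show ?thesis .
qed

end
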